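(* Let $(U,\{\mathcal H_n\}_{n\in\mathbb Z})$ with $\mathcal H_n=\mathbb C^2$ be a one-dimensional quantum walk given, for all $n\in\mathbb Z$, by $$U_{n-1,n}=|n-1\rangle\langle n|\otimes\begin{bmatrix} e^{\mathrm i\sigma_n}s_n & e^{\mathrm i\nu_n}r_n \\ 0 & 0\end{bmatrix},\qquad U_{n+1,n}=|n+1\rangle\langle n|\otimes\begin{bmatrix} 0 & 0 \\ {e}^{\mathrm i\mu_n}r_n & e^{\mathrm i\tau_n}s_n\end{bmatrix},$$ where $r_n,s_n\ge0$ and $\mu_n,\nu_n,\sigma_n,\tau_n\in\mathbb R$, and let $\delta_n\in\mathbb R$ be such that $e^{\mathrm i\delta_n}$ is the determinant of the (unitary) matrix $$U_n=\begin{bmatrix} e^{\mathrm i\sigma_n}s_n & e^{\mathrm i\nu_n}r_n \\ {e}^{\mathrm i\mu_n}r_n & e^{\mathrm i\tau_n}s_n\end{bmatrix}.$$ Then $(U,\{\mathcal H_n\}_{n\in\mathbb Z})$ is a Szegedy walk if and only if there exist real numbers $\lambda$ and $\theta_n$ ($n\in\mathbb Z$) such that $$\theta_n-\theta_{n-1}-2\lambda=\delta_n\pmod{2\pi}\quad\text{for all }n\in\mathbb Z$$ and $$\theta_n-\lambda=\mu_n\pmod{\pi}\quad\text{for all }n\in\mathbb Z\text{ with }r_n\neq0.$$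
   Context: A quantum walk is a pair $(U,\{\mathcal H_v\}_{v\in V})$ where $V$ is a countable set, $\{\mathcal H_v\}_{v\in V}$ is a family of separable Hilbert spaces, and $U$ is a unitary operator on $\mathcal H=\bigoplus_{v\in V}\mathcal H_v$. $P_v$ is the orthogonal projection onto $\mathcal H_v$ and $U_{uv}=U_{u,v}=P_uUP_v$. The graph $(V,D)$ of the walk is the directed (multi)graph in which the number of directed edges from $v$ to $u$ is $\mathrm{card}(u,v)=\operatorname{rank}U_{uv}$. The walk is standard if its graph is locally finite and symmetric ($\mathrm{card}(u,v)=\mathrm{card}(v,u)$) and for every $v$ the number of edges with origin $v$ equals $\dim\mathcal H_v$. It is one-dimensional if $V=\mathbb Z$, $\dim\mathcal H_n=2$ for all $n$, and $\operatorname{rank}U_{m,n}=1$ when $|m-n|=1$ and $U_{m,n}=0$ otherwise (such walks are standard). For a $2\times2$ matrix $A$, $|m\rangle\langle n|\otimes A$ is the operator that sends $\xi\in\mathcal H_n=\mathbb C^2$ to $A\xi\in\mathcal H_m=\mathbb C^2$ and vanishes on $\mathcal H_l$, $l\ne n$. A standard quantum walk is a Szegedy walk if there exist a self-adjoint unitary operator $S$ on $\mathcal H$, a real number $\lambda$, and unit vectors $\phi_v\in\mathcal H_v$ such that $e^{\mathrm i\lambda}SU=\bigoplus_{v\in V}C_v$, where $C_v=2|\phi_v\rangle\langle\phi_v|-I_{\mathcal H_v}$ on $\mathcal H_v$. *)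

theory Defs
  imports
    "HOL-Analysis.Analysis"
    "HOL-Library.Function_Algebras"
    "HOL-Library.Real_Mod"
begin

section \<open>Complex vector spaces and complex Hilbert spaces\<close>

class scaleC =
  fixes scaleC :: "complex \<Rightarrow> 'a \<Rightarrow> 'a"  (infixr \<open>*\<^sub>C\<close> 75)

class complex_vector = scaleC + ab_group_add +
  assumes scaleC_add_right: "a *\<^sub>C (x + y) = a *\<^sub>C x + a *\<^sub>C y"
    and scaleC_add_left: "(a + b) *\<^sub>C x = a *\<^sub>C x + b *\<^sub>C x"
    and scaleC_scaleC: "a *\<^sub>C b *\<^sub>C x = (a * b) *\<^sub>C x"
    and scaleC_one: "1 *\<^sub>C x = x"

global_interpretation complex_vector: vector_space "scaleC :: complex \<Rightarrow> 'a \<Rightarrow> 'a :: complex_vector"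
  defines csubspace = complex_vector.subspace
    and cspan = complex_vector.span
    and cdim = complex_vector.dim
  by unfold_locales (fact scaleC_add_right scaleC_add_left scaleC_scaleC scaleC_one)+

text \<open>The inner product is conjugate linear in the first argument.  The real inner product and
  norm of the underlying \<^class>\<open>real_inner\<close> space are those induced by it.\<close>

class complex_inner = complex_vector + real_inner +
  fixes cinner :: "'a \<Rightarrow> 'a \<Rightarrow> complex"
  assumes scaleR_scaleC: "scaleR r x = complex_of_real r *\<^sub>C x"
    and cinner_commute: "cinner x y = cnj (cinner y x)"
    and cinner_add_right: "cinner x (y + z) = cinner x y + cinner x z"
    and cinner_scaleC_right: "cinner x (c *\<^sub>C y) = c * cinner x y"
    and Re_cinner: "Re (cinner x y) = inner x y"

class complex_hilbert = complex_inner + complete_space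

instantiation complex :: complex_hilbert
begin
definition scaleC_complex :: "complex \<Rightarrow> complex \<Rightarrow> complex" where "scaleC_complex c x = c * x"
definition cinner_complex :: "complex \<Rightarrow> complex \<Rightarrow> complex" where "cinner_complex x y = cnj x * y"
instance
  by standard
    (auto simp: scaleC_complex_def cinner_complex_def algebra_simps scaleR_conv_of_real
      inner_complex_def)
end

instantiation vec :: (scaleC, finite) scaleC
begin
definition scaleC_vec :: "complex \<Rightarrow> 'a ^ 'b \<Rightarrow> 'a ^ 'b" where
  "scaleC_vec c x = (\<chi> i. c *\<^sub>C (x $ i))"
instance ..
end

instance vec :: (complex_vector, finite) complex_vector
  by standard
    (simp_all add: scaleC_vec_def vec_eq_iff scaleC_add_right scaleC_add_left scaleC_scaleC
      scaleC_one)

instantiation vec :: (complex_inner, finite) complex_inner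
begin
definition cinner_vec :: "'a ^ 'b \<Rightarrow> 'a ^ 'b \<Rightarrow> complex" where
  "cinner_vec x y = (\<Sum>i\<in>UNIV. cinner (x $ i) (y $ i))"
instance
proof
  fix x y z :: "'a ^ 'b" and r :: real and c :: complex
  show "scaleR r x = complex_of_real r *\<^sub>C x"
    by (simp add: vec_eq_iff scaleC_vec_def scaleR_scaleC)
  show "cinner x y = cnj (cinner y x)"
    unfolding cinner_vec_def cnj_sum by (rule sum.cong [OF refl]) (rule cinner_commute)
  show "cinner x (y + z) = cinner x y + cinner x z"
    by (simp add: cinner_vec_def cinner_add_right sum.distrib)
  show "cinner x (c *\<^sub>C y) = c * cinner x y"
    by (simp add: cinner_vec_def scaleC_vec_def cinner_scaleC_right sum_distrib_left)
  show "Re (cinner x y) = inner x y"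
    by (simp add: cinner_vec_def inner_vec_def Re_cinner)
qed
end

instance vec :: (complex_hilbert, finite) complex_hilbert ..

instantiation "fun" :: (type, complex_vector) complex_vector
begin
definition scaleC_fun :: "complex \<Rightarrow> ('a \<Rightarrow> 'b) \<Rightarrow> 'a \<Rightarrow> 'b" where
  "scaleC_fun c f = (\<lambda>x. c *\<^sub>C f x)"
instance
  by standard
    (simp_all add: scaleC_fun_def fun_eq_iff scaleC_add_right scaleC_add_left scaleC_scaleC
      scaleC_one)
end

text \<open>Dimension with value \<open>\<infinity>\<close> for infinite-dimensional subspaces, where \<^const>\<open>cdim\<close> is \<open>0\<close>.\<close>

definition cdimension :: "'a::complex_vector set \<Rightarrow> enat" where
  "cdimension S = (if \<exists>B. finite B \<and> S \<subseteq> cspan B then enat (cdim S) else \<infinity>)"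

section \<open>Hilbert direct sums and operators on them\<close>

text \<open>A family of Hilbert spaces is a family \<open>H\<close> of closed subspaces of one ambient Hilbert space
  (every family of separable spaces has an isometric copy of this form).  The subspaces \<open>H v\<close> are
  unrelated to each other, as the direct sum is external: a vector of the sum is a square-summable
  function \<open>\<psi>\<close> with \<open>\<psi> v \<in> H v\<close>.  Operators are functions of which only the
  values on the direct sum matter.\<close>

definition hilbert_sum :: "('v \<Rightarrow> 'h::complex_hilbert set) \<Rightarrow> ('v \<Rightarrow> 'h) set" where
  "hilbert_sum H = {\<psi>. (\<forall>v. \<psi> v \<in> H v) \<and> (\<lambda>v. (norm (\<psi> v))\<^sup>2) summable_on UNIV}"

definition sum_inner :: "('v \<Rightarrow> 'h::complex_hilbert) \<Rightarrow> ('v \<Rightarrow> 'h) \<Rightarrow> complex" where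
  "sum_inner \<psi> \<phi> = (\<Sum>\<^sub>\<infinity>v. cinner (\<psi> v) (\<phi> v))"

definition unitary_on ::
  "('v \<Rightarrow> 'h::complex_hilbert set) \<Rightarrow> (('v \<Rightarrow> 'h) \<Rightarrow> ('v \<Rightarrow> 'h)) \<Rightarrow> bool" where
  "unitary_on H T \<longleftrightarrow>
     (\<forall>\<psi>\<in>hilbert_sum H. \<forall>\<phi>\<in>hilbert_sum H. T (\<psi> + \<phi>) = T \<psi> + T \<phi>) \<and>
     (\<forall>\<psi>\<in>hilbert_sum H. \<forall>c. T (c *\<^sub>C \<psi>) = c *\<^sub>C T \<psi>) \<and>
     (\<forall>\<psi>\<in>hilbert_sum H. \<forall>\<phi>\<in>hilbert_sum H. sum_inner (T \<psi>) (T \<phi>) = sum_inner \<psi> \<phi>) \<and>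
     T ` hilbert_sum H = hilbert_sum H"

definition selfadjoint_on ::
  "('v \<Rightarrow> 'h::complex_hilbert set) \<Rightarrow> (('v \<Rightarrow> 'h) \<Rightarrow> ('v \<Rightarrow> 'h)) \<Rightarrow> bool" where
  "selfadjoint_on H T \<longleftrightarrow>
     (\<forall>\<psi>\<in>hilbert_sum H. \<forall>\<phi>\<in>hilbert_sum H. sum_inner (T \<psi>) \<phi> = sum_inner \<psi> (T \<phi>))"

definition proj_at :: "'v \<Rightarrow> ('v \<Rightarrow> 'h::complex_hilbert) \<Rightarrow> ('v \<Rightarrow> 'h)" where
  "proj_at v \<psi> = (\<lambda>w. if w = v then \<psi> v else 0)"

definition ket_bra :: "'v \<Rightarrow> 'v \<Rightarrow> complex ^ 'd ^ 'd \<Rightarrow> ('v \<Rightarrow> complex ^ 'd) \<Rightarrow> ('v \<Rightarrow> complex ^ 'd)" where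
  "ket_bra m n A \<psi> = (\<lambda>l. if l = m then A *v \<psi> n else 0)"

section \<open>Quantum walks\<close>

definition quantum_walk ::
  "(('v::countable \<Rightarrow> 'h::complex_hilbert) \<Rightarrow> ('v \<Rightarrow> 'h)) \<Rightarrow> ('v \<Rightarrow> 'h set) \<Rightarrow> bool" where
  "quantum_walk U H \<longleftrightarrow>
     (\<forall>v. csubspace (H v) \<and> closed (H v) \<and>
        (\<exists>D. countable D \<and> D \<subseteq> H v \<and> H v \<subseteq> closure D)) \<and>
     unitary_on H U"

definition walk_block ::
  "(('v \<Rightarrow> 'h::complex_hilbert) \<Rightarrow> ('v \<Rightarrow> 'h)) \<Rightarrow> 'v \<Rightarrow> 'v \<Rightarrow> ('v \<Rightarrow> 'h) \<Rightarrow> ('v \<Rightarrow> 'h)" where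
  "walk_block U u v = proj_at u \<circ> U \<circ> proj_at v"

definition walk_card ::
  "(('v \<Rightarrow> 'h::complex_hilbert) \<Rightarrow> ('v \<Rightarrow> 'h)) \<Rightarrow> ('v \<Rightarrow> 'h set) \<Rightarrow> 'v \<Rightarrow> 'v \<Rightarrow> enat" where
  "walk_card U H u v = cdimension (walk_block U u v ` hilbert_sum H)"

text \<open>The edge \<open>(v, u, k)\<close> is the \<open>k\<close>-th one with origin \<open>v\<close> and terminus \<open>u\<close>.\<close>

definition walk_edges ::
  "(('v \<Rightarrow> 'h::complex_hilbert) \<Rightarrow> ('v \<Rightarrow> 'h)) \<Rightarrow> ('v \<Rightarrow> 'h set) \<Rightarrow> ('v \<times> 'v \<times> nat) set" where
  "walk_edges U H = {(v, u, k). enat k < walk_card U H u v}"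

definition standard_walk ::
  "(('v::countable \<Rightarrow> 'h::complex_hilbert) \<Rightarrow> ('v \<Rightarrow> 'h)) \<Rightarrow> ('v \<Rightarrow> 'h set) \<Rightarrow> bool" where
  "standard_walk U H \<longleftrightarrow>
     quantum_walk U H \<and>
     (\<forall>x. finite {(v, u, k). (v, u, k) \<in> walk_edges U H \<and> (v = x \<or> u = x)}) \<and>
     (\<forall>u v. walk_card U H u v = walk_card U H v u) \<and>
     (\<forall>x. enat (card {(v, u, k). (v, u, k) \<in> walk_edges U H \<and> v = x}) = cdimension (H x))"

definition one_dimensional_walk ::
  "((int \<Rightarrow> 'h::complex_hilbert) \<Rightarrow> (int \<Rightarrow> 'h)) \<Rightarrow> (int \<Rightarrow> 'h set) \<Rightarrow> bool" where
  "one_dimensional_walk U H \<longleftrightarrow>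
     quantum_walk U H \<and>
     (\<forall>n. cdimension (H n) = 2) \<and>
     (\<forall>m n. \<bar>m - n\<bar> = 1 \<longrightarrow> walk_card U H m n = 1) \<and>
     (\<forall>m n. \<bar>m - n\<bar> \<noteq> 1 \<longrightarrow> (\<forall>\<psi>\<in>hilbert_sum H. walk_block U m n \<psi> = 0))"

definition szegedy_walk ::
  "(('v::countable \<Rightarrow> 'h::complex_hilbert) \<Rightarrow> ('v \<Rightarrow> 'h)) \<Rightarrow> ('v \<Rightarrow> 'h set) \<Rightarrow> bool" where
  "szegedy_walk U H \<longleftrightarrow>
     standard_walk U H \<and>
     (\<exists>S lam \<phi>.
        unitary_on H S \<and> selfadjoint_on H S \<and>
        (\<forall>v. \<phi> v \<in> H v \<and> norm (\<phi> v) = 1) \<and>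
        (\<forall>\<psi>\<in>hilbert_sum H.
           cis lam *\<^sub>C S (U \<psi>) = (\<lambda>v. (2 * cinner (\<phi> v) (\<psi> v)) *\<^sub>C \<phi> v - \<psi> v)))"

end

(*
  The walk sends (psi n) to the coin image (W n)(psi n), whose first component moves to n - 1 and whose
  second moves to n + 1.  With exp(i lam) S U = C for a direct sum C of reflections, S is
  exp(i lam) U C, so S also moves only to neighbouring sites, and self-adjointness together with
  unitarity leaves no freedom but a phase theta n on the edge between n and n + 1: S is a flip-flop
  shift.  The walk is thus a Szegedy walk iff every coin is exp(-i lam) times an antidiagonal matrix
  with entries exp(-i theta (n - 1)), exp(i theta n) times a reflection.  As the reflections in unit vectors
  are exactly the Hermitian unitary 2x2 matrices of determinant -1, comparing determinants gives
  the condition modulo 2 pi, and reality of the diagonal entry gives the condition modulo pi.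
*)

theory Submission
  imports Defs
begin

section \<open>Complex inner products and their coordinates on C^2\<close>

lemma cinner_zero_right [simp]: "cinner x 0 = 0"
  using cinner_add_right [of x 0 0] by simp

lemma cinner_zero_left [simp]: "cinner 0 x = 0"
  using cinner_commute [of 0 x] by simp

lemma cinner_minus_right [simp]: "cinner x (- y) = - cinner x y"
  using cinner_add_right [of x y "- y"] by (simp add: eq_neg_iff_add_eq_0 add.commute)

lemma cinner_diff_right: "cinner x (y - z) = cinner x y - cinner x z"
  using cinner_add_right [of x y "- z"] by simp

lemma cinner_eq_zero_iff [simp]: "cinner x x = 0 \<longleftrightarrow> x = 0"
  using Re_cinner [of x x] by auto

lemma cinner_self: "cinner x x = complex_of_real ((norm x)\<^sup>2)"
proof (rule complex_eqI)
  show "Im (cinner x x) = Im (complex_of_real ((norm x)\<^sup>2))"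
    using arg_cong [OF cinner_commute [of x x], of Im] by simp
qed (simp add: Re_cinner power2_norm_eq_inner)

lemma cinner_vec2: "cinner x y = cnj (x $ 1) * y $ 1 + cnj (x $ 2) * y $ 2"
  for x y :: "complex ^ 2"
  by (simp add: cinner_vec_def sum_2 cinner_complex_def)

lemma norm_vec2: "(norm x)\<^sup>2 = (cmod (x $ 1))\<^sup>2 + (cmod (x $ 2))\<^sup>2"
  for x :: "complex ^ 2"
  by (simp add: norm_vec_def L2_set_def sum_2)

lemma scaleC_vec_nth [simp]: "(c *\<^sub>C x) $ i = c *\<^sub>C (x $ i)"
  by (simp add: scaleC_vec_def)

section \<open>Site projections and locality of unitaries on the direct sum\<close>

lemma proj_at_nth: "proj_at v \<psi> w = (if w = v then \<psi> v else 0)"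
  by (simp add: proj_at_def)

lemma infsum_single:
  fixes f :: "'a \<Rightarrow> 'b::{comm_monoid_add, t2_space}"
  assumes "\<And>w. w \<noteq> v \<Longrightarrow> f w = 0"
  shows "(\<Sum>\<^sub>\<infinity>w. f w) = f v"
proof -
  have "(\<Sum>\<^sub>\<infinity>w. f w) = infsum f {v}"
    by (rule infsum_cong_neutral) (use assms in auto)
  then show ?thesis
    by simp
qed

lemma sum_inner_proj_at_left: "sum_inner (proj_at v \<psi>) \<phi> = cinner (\<psi> v) (\<phi> v)"
  unfolding sum_inner_def
  by (subst infsum_single [of v]) (auto simp: proj_at_nth)

lemma sum_inner_proj_at_right: "sum_inner \<phi> (proj_at v \<psi>) = cinner (\<phi> v) (\<psi> v)"
  unfolding sum_inner_def
  by (subst infsum_single [of v]) (auto simp: proj_at_nth)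

lemma hilbert_sum_UNIV: "\<psi> \<in> hilbert_sum (\<lambda>_. UNIV) \<longleftrightarrow> (\<lambda>v. (norm (\<psi> v))\<^sup>2) summable_on UNIV"
  by (simp add: hilbert_sum_def)

lemma hilbert_sum_UNIV_restrict:
  assumes "\<psi> \<in> hilbert_sum (\<lambda>_. UNIV)"
  shows "(\<lambda>v. if v \<in> A then \<psi> v else 0) \<in> hilbert_sum (\<lambda>_. UNIV)"
  unfolding hilbert_sum_UNIV
  by (rule summable_on_comparison_test [OF assms [unfolded hilbert_sum_UNIV]]) auto

lemma proj_at_in_hilbert_sum [simp]: "proj_at v \<psi> \<in> hilbert_sum (\<lambda>_. UNIV)"
proof -
  have "(\<lambda>w. (norm (proj_at v \<psi> w))\<^sup>2) summable_on UNIV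
    \<longleftrightarrow> (\<lambda>w. (norm (proj_at v \<psi> w))\<^sup>2) summable_on {v}"
    by (rule summable_on_cong_neutral) (auto simp: proj_at_nth)
  then show ?thesis
    by (simp add: hilbert_sum_UNIV)
qed

text \<open>No continuity argument is needed: a preimage \<open>\<zeta>\<close> of \<open>proj_at v (U \<psi>)\<close> vanishes wherever
  the block of \<open>U\<close> ending in \<open>v\<close> does, hence is orthogonal to \<open>\<psi>\<close>.\<close>

lemma unitary_on_local:
  assumes U: "unitary_on (\<lambda>_. UNIV) U"
    and block: "\<And>w \<xi>. w \<notin> A \<Longrightarrow> \<xi> \<in> hilbert_sum (\<lambda>_. UNIV) \<Longrightarrow> U (proj_at w \<xi>) v = 0"
    and \<psi>: "\<psi> \<in> hilbert_sum (\<lambda>_. UNIV)"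
    and supp: "\<And>w. w \<in> A \<Longrightarrow> \<psi> w = 0"
  shows "U \<psi> v = 0"
proof -
  have iso: "sum_inner (U \<xi>) (U \<eta>) = sum_inner \<xi> \<eta>"
    if "\<xi> \<in> hilbert_sum (\<lambda>_. UNIV)" "\<eta> \<in> hilbert_sum (\<lambda>_. UNIV)" for \<xi> \<eta>
    using U that by (simp add: unitary_on_def)
  have "proj_at v (U \<psi>) \<in> U ` hilbert_sum (\<lambda>_. UNIV)"
    using U by (simp add: unitary_on_def)
  then obtain \<zeta> where \<zeta>: "\<zeta> \<in> hilbert_sum (\<lambda>_. UNIV)" "U \<zeta> = proj_at v (U \<psi>)"
    by auto
  have "\<zeta> w = 0" if "w \<notin> A" for w
  proof -
    have "cinner (\<zeta> w) (\<zeta> w) = sum_inner (proj_at w \<zeta>) \<zeta>"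
      by (simp add: sum_inner_proj_at_left)
    also have "\<dots> = sum_inner (U (proj_at w \<zeta>)) (proj_at v (U \<psi>))"
      using iso [of "proj_at w \<zeta>" \<zeta>] \<zeta> by simp
    also have "\<dots> = 0"
      by (simp add: sum_inner_proj_at_right block [OF that \<zeta>(1)])
    finally show ?thesis
      by simp
  qed
  then have "cinner (\<zeta> w) (\<psi> w) = 0" for w
    using supp by (cases "w \<in> A") auto
  then have "sum_inner \<zeta> \<psi> = 0"
    by (simp add: sum_inner_def)
  then have "cinner (U \<psi> v) (U \<psi> v) = 0"
    using iso [OF \<zeta>(1) \<psi>] \<zeta>(2) by (simp add: sum_inner_proj_at_left)
  then show ?thesis
    by simp
qed

lemma hilbert_sum_UNIV_add:
  assumes "\<psi> \<in> hilbert_sum (\<lambda>_. UNIV)" "\<phi> \<in> hilbert_sum (\<lambda>_. UNIV)"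
  shows "\<psi> + \<phi> \<in> hilbert_sum (\<lambda>_. UNIV)"
  unfolding hilbert_sum_UNIV
proof (rule summable_on_comparison_test)
  show "(\<lambda>v. 2 * (norm (\<psi> v))\<^sup>2 + 2 * (norm (\<phi> v))\<^sup>2) summable_on UNIV"
    using assms by (intro summable_on_add summable_on_cmult_right) (auto simp: hilbert_sum_UNIV)
  fix v
  have "(norm (\<psi> v + \<phi> v))\<^sup>2 \<le> (norm (\<psi> v) + norm (\<phi> v))\<^sup>2"
    by (simp add: norm_triangle_ineq power_mono)
  also have "\<dots> \<le> 2 * (norm (\<psi> v))\<^sup>2 + 2 * (norm (\<phi> v))\<^sup>2"
    using zero_le_power2 [of "norm (\<psi> v) - norm (\<phi> v)"]
    by (simp add: power2_eq_square algebra_simps)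
  finally show "(norm ((\<psi> + \<phi>) v))\<^sup>2 \<le> 2 * (norm (\<psi> v))\<^sup>2 + 2 * (norm (\<phi> v))\<^sup>2"
    by simp
qed auto

section \<open>Walks made of a coin at each site and a shift to the neighbours\<close>

text \<open>\<open>U_proj_at\<close> prescribes \<open>U\<close> only on vectors supported at one
  site, since this is what the blocks of a walk determine. \<open>U_apply\<close> extends the
  formula to every vector, and \<open>cinner_coin\<close> derives from unitarity of \<open>U\<close>
  that each coin \<open>W n\<close> is isometric.\<close>

locale coined_shift =
  fixes U :: "(int \<Rightarrow> complex ^ 2) \<Rightarrow> (int \<Rightarrow> complex ^ 2)" and W :: "int \<Rightarrow> complex ^ 2 ^ 2"
  assumes unitary: "unitary_on (\<lambda>_. UNIV) U"
    and U_proj_at: "\<psi> \<in> hilbert_sum (\<lambda>_. UNIV) \<Longrightarrow> U (proj_at n \<psi>) m =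
      (if m = n - 1 then vector [(W n *v \<psi> n) $ 1, 0]
       else if m = n + 1 then vector [0, (W n *v \<psi> n) $ 2] else 0)"
begin

lemma isometry:
  "\<psi> \<in> hilbert_sum (\<lambda>_. UNIV) \<Longrightarrow> \<phi> \<in> hilbert_sum (\<lambda>_. UNIV) \<Longrightarrow>
    sum_inner (U \<psi>) (U \<phi>) = sum_inner \<psi> \<phi>"
  using unitary by (simp add: unitary_on_def)

lemma U_in_hilbert_sum:
  "\<psi> \<in> hilbert_sum (\<lambda>_. UNIV) \<Longrightarrow> U \<psi> \<in> hilbert_sum (\<lambda>_. UNIV)"
  using unitary by (auto simp: unitary_on_def)

text \<open>Additivity of \<open>U\<close> handles only finite decompositions, so
  \<open>\<psi>\<close> is cut into its parts at \<open>m + 1\<close> and \<open>m - 1\<close> and a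
  remainder \<open>\<rho>\<close>, whose contribution at \<open>m\<close> vanishes by
  \<open>unitary_on_local\<close>.\<close>

lemma U_apply:
  assumes \<psi>: "\<psi> \<in> hilbert_sum (\<lambda>_. UNIV)"
  shows "U \<psi> m = vector [(W (m + 1) *v \<psi> (m + 1)) $ 1, (W (m - 1) *v \<psi> (m - 1)) $ 2]"
proof -
  define \<rho> where "\<rho> = (\<lambda>v. if v \<in> - {m + 1, m - 1} then \<psi> v else 0)"
  have \<rho>: "\<rho> \<in> hilbert_sum (\<lambda>_. UNIV)"
    unfolding \<rho>_def by (rule hilbert_sum_UNIV_restrict [OF \<psi>])
  have add: "U (\<xi> + \<eta>) = U \<xi> + U \<eta>"
    if "\<xi> \<in> hilbert_sum (\<lambda>_. UNIV)" "\<eta> \<in> hilbert_sum (\<lambda>_. UNIV)" for \<xi> \<eta>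
    using unitary that by (simp add: unitary_on_def)
  have "\<psi> = proj_at (m + 1) \<psi> + (proj_at (m - 1) \<psi> + \<rho>)"
    by (auto simp: fun_eq_iff proj_at_nth \<rho>_def)
  then have "U \<psi> = U (proj_at (m + 1) \<psi> + (proj_at (m - 1) \<psi> + \<rho>))"
    by simp
  also have "\<dots> = U (proj_at (m + 1) \<psi>) + (U (proj_at (m - 1) \<psi>) + U \<rho>)"
    by (simp add: add hilbert_sum_UNIV_add \<rho>)
  also have "U \<rho> m = 0 \<Longrightarrow> (U (proj_at (m + 1) \<psi>) + (U (proj_at (m - 1) \<psi>) + U \<rho>)) m
    = vector [(W (m + 1) *v \<psi> (m + 1)) $ 1, (W (m - 1) *v \<psi> (m - 1)) $ 2]"
    by (simp add: U_proj_at \<psi> vec_eq_iff forall_2)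
  moreover have "U \<rho> m = 0"
    by (rule unitary_on_local [OF unitary, where A = "{m + 1, m - 1}"])
      (use \<rho> in \<open>auto simp: U_proj_at \<rho>_def\<close>)
  ultimately show ?thesis
    by metis
qed

lemma U_proj_at_const: "U (proj_at n (\<lambda>_. x)) m =
  (if m = n - 1 then vector [(W n *v x) $ 1, 0]
   else if m = n + 1 then vector [0, (W n *v x) $ 2] else 0)"
proof -
  \<comment> \<open>A nonzero constant function is not square-summable, so \<open>U_proj_at\<close>
    cannot be applied to it directly; it is applied to its projection, and projecting twice changes
    nothing.\<close>
  have "proj_at n (proj_at n (\<lambda>_. x)) = proj_at n (\<lambda>_. x)"
    by (simp add: proj_at_def)
  then show ?thesis
    using U_proj_at [OF proj_at_in_hilbert_sum [of n "\<lambda>_. x"], of n m] by (simp add: proj_at_nth)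
qed

text \<open>The two components of the coin image land at different sites, so the inner product of
  the images under \<open>U\<close> is a sum over two sites that reassembles the inner product in
  C^2.\<close>

lemma cinner_coin: "cinner (W n *v x) (W n *v y) = cinner x y"
proof -
  let ?X = "U (proj_at n (\<lambda>_. x))" and ?Y = "U (proj_at n (\<lambda>_. y))"
  have "cinner x y = sum_inner ?X ?Y"
    by (simp add: isometry sum_inner_proj_at_left proj_at_nth)
  also have "\<dots> = (\<Sum>\<^sub>\<infinity>m\<in>{n - 1, n + 1}. cinner (?X m) (?Y m))"
    unfolding sum_inner_def by (rule infsum_cong_neutral) (auto simp: U_proj_at_const)
  also have "\<dots> = cinner (W n *v x) (W n *v y)"
    by (simp add: U_proj_at_const cinner_vec2)
  finally show ?thesis ..
qed

end

lemma cinner_scaleC_left: "cinner (c *\<^sub>C x) y = cnj c * cinner x y"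
  by (metis cinner_commute cinner_scaleC_right complex_cnj_cnj complex_cnj_mult)

lemma cinner_diff_left: "cinner (x - y) z = cinner x z - cinner y z"
  by (metis cinner_commute cinner_diff_right complex_cnj_cnj complex_cnj_diff)

section \<open>Flip-flop shifts with a phase on each edge\<close>

text \<open>The number \<open>\<theta> m\<close> belongs to the edge between \<open>m\<close> and
  \<open>m + 1\<close>: the first component at \<open>m\<close> and the second at
  \<open>m + 1\<close> are exchanged, with conjugate phases in the two directions.\<close>

definition flip_flop :: "(int \<Rightarrow> real) \<Rightarrow> (int \<Rightarrow> complex ^ 2) \<Rightarrow> (int \<Rightarrow> complex ^ 2)" where
  "flip_flop \<theta> \<psi> = (\<lambda>m. vector [cis (- \<theta> m) * \<psi> (m + 1) $ 2, cis (\<theta> (m - 1)) * \<psi> (m - 1) $ 1])"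

text \<open>Summability of each component separately is what allows the inner product in
  \<open>flip_flop_isometry\<close> to be split before its two parts are shifted in opposite
  directions.\<close>

lemma summable_on_cnj_mult_nth:
  fixes \<psi> \<phi> :: "'v \<Rightarrow> complex ^ 2"
  assumes "\<psi> \<in> hilbert_sum (\<lambda>_. UNIV)" "\<phi> \<in> hilbert_sum (\<lambda>_. UNIV)"
  shows "(\<lambda>m. cnj (\<psi> m $ i) * \<phi> m $ i) summable_on UNIV"
proof (rule abs_summable_summable, rule summable_on_comparison_test)
  show "(\<lambda>m. (norm (\<psi> m))\<^sup>2 + (norm (\<phi> m))\<^sup>2) summable_on UNIV"
    using assms by (intro summable_on_add) (auto simp: hilbert_sum_UNIV)
  fix m
  have "norm (cnj (\<psi> m $ i) * \<phi> m $ i) \<le> norm (\<psi> m) * norm (\<phi> m)"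
    by (simp add: norm_mult mult_mono Finite_Cartesian_Product.norm_nth_le)
  also have "\<dots> \<le> (norm (\<psi> m))\<^sup>2 + (norm (\<phi> m))\<^sup>2"
    using sum_squares_bound [of "norm (\<psi> m)" "norm (\<phi> m)"] 
      mult_nonneg_nonneg [OF norm_ge_zero [of "\<psi> m"] norm_ge_zero [of "\<phi> m"]] by linarith
  finally show "norm (cnj (\<psi> m $ i) * \<phi> m $ i) \<le> (norm (\<psi> m))\<^sup>2 + (norm (\<phi> m))\<^sup>2" .
qed simp

lemma bij_add_int: "bij (\<lambda>m. m + c)" for c :: int
  by (rule bij_betw_byWitness [where f' = "\<lambda>m. m - c"]) auto

lemma bij_diff_int: "bij (\<lambda>m. m - c)" for c :: int
  by (rule bij_betw_byWitness [where f' = "\<lambda>m. m + c"]) auto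

lemma flip_flop_in_hilbert_sum:
  assumes "\<psi> \<in> hilbert_sum (\<lambda>_. UNIV)"
  shows "flip_flop \<theta> \<psi> \<in> hilbert_sum (\<lambda>_. UNIV)"
proof -
  have "(\<lambda>m. (cmod (\<psi> m $ i))\<^sup>2) summable_on UNIV" for i
    by (rule summable_on_comparison_test [OF assms [unfolded hilbert_sum_UNIV]])
      (auto simp: Finite_Cartesian_Product.norm_nth_le power_mono)
  then have "(\<lambda>m. (cmod (\<psi> (m + 1) $ 2))\<^sup>2) summable_on UNIV"
      "(\<lambda>m. (cmod (\<psi> (m - 1) $ 1))\<^sup>2) summable_on UNIV"
    using summable_on_reindex_bij_betw [OF bij_add_int, of "\<lambda>m. (cmod (\<psi> m $ 2))\<^sup>2"]
      summable_on_reindex_bij_betw [OF bij_diff_int, of "\<lambda>m. (cmod (\<psi> m $ 1))\<^sup>2"] by auto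
  then show ?thesis
    by (simp add: hilbert_sum_UNIV norm_vec2 flip_flop_def norm_mult summable_on_add)
qed

lemma flip_flop_involution: "flip_flop \<theta> (flip_flop \<theta> \<psi>) = \<psi>"
  by (simp add: flip_flop_def fun_eq_iff vec_eq_iff forall_2 cis_mult flip: mult.assoc)

text \<open>The phases cancel against their conjugates, and the remaining shifts of the two
  component sums are bijective reindexings of the integers.\<close>

lemma flip_flop_isometry:
  assumes "\<psi> \<in> hilbert_sum (\<lambda>_. UNIV)" "\<phi> \<in> hilbert_sum (\<lambda>_. UNIV)"
  shows "sum_inner (flip_flop \<theta> \<psi>) (flip_flop \<theta> \<phi>) = sum_inner \<psi> \<phi>"
proof -
  define f where "f i m = cnj (\<psi> m $ i) * \<phi> m $ i" for i m
  have f: "f i summable_on UNIV" for i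
    unfolding f_def by (rule summable_on_cnj_mult_nth [OF assms])
  have cis: "cnj (cis t * a) * (cis t * b) = cnj a * b" for t a b
    by (simp add: cis_cnj) (simp add: cis_mult flip: mult.assoc)
  have "sum_inner (flip_flop \<theta> \<psi>) (flip_flop \<theta> \<phi>) = (\<Sum>\<^sub>\<infinity>m. f 2 (m + 1) + f 1 (m - 1))"
    unfolding sum_inner_def flip_flop_def cinner_vec2 f_def vector_2 cis ..
  also have "\<dots> = (\<Sum>\<^sub>\<infinity>m. f 2 (m + 1)) + (\<Sum>\<^sub>\<infinity>m. f 1 (m - 1))"
    using f summable_on_reindex_bij_betw [OF bij_add_int, of "f 2"]
      summable_on_reindex_bij_betw [OF bij_diff_int, of "f 1"] by (intro infsum_add) auto
  also have "\<dots> = infsum (f 2) UNIV + infsum (f 1) UNIV"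
    using infsum_reindex_bij_betw [OF bij_add_int, of "f 2"]
      infsum_reindex_bij_betw [OF bij_diff_int, of "f 1"] by simp
  also have "\<dots> = sum_inner \<psi> \<phi>"
    using infsum_add [OF f f, of 1 2] by (simp add: sum_inner_def cinner_vec2 f_def)
  finally show ?thesis .
qed

lemma unitary_on_flip_flop: "unitary_on (\<lambda>_. UNIV) (flip_flop \<theta>)"
  unfolding unitary_on_def
proof (intro conjI ballI allI)
  show "flip_flop \<theta> ` hilbert_sum (\<lambda>_. UNIV) = hilbert_sum (\<lambda>_. UNIV)"
    by (force simp: image_iff intro: flip_flop_in_hilbert_sum flip_flop_involution [symmetric])
  fix \<psi> \<phi> :: "int \<Rightarrow> complex ^ 2"
  assume "\<psi> \<in> hilbert_sum (\<lambda>_. UNIV)" "\<phi> \<in> hilbert_sum (\<lambda>_. UNIV)"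
  then show "sum_inner (flip_flop \<theta> \<psi>) (flip_flop \<theta> \<phi>) = sum_inner \<psi> \<phi>"
    by (rule flip_flop_isometry)
qed (auto simp: flip_flop_def fun_eq_iff vec_eq_iff forall_2 algebra_simps
  scaleC_fun_def scaleC_complex_def)

text \<open>An isometric involution \<open>T\<close> is self-adjoint: <T x, y> = <T x, T (T y)> =
  <x, T y>.\<close>

lemma selfadjoint_on_flip_flop: "selfadjoint_on (\<lambda>_. UNIV) (flip_flop \<theta>)"
  unfolding selfadjoint_on_def
  by (metis flip_flop_in_hilbert_sum flip_flop_involution flip_flop_isometry)

section \<open>Reflections in unit vectors of C^2\<close>

definition coin_reflection :: "complex ^ 2 \<Rightarrow> complex ^ 2 \<Rightarrow> complex ^ 2" where
  "coin_reflection p x = (2 * cinner p x) *\<^sub>C p - x"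

lemma coin_reflection_zero [simp]: "coin_reflection p 0 = 0"
  by (simp add: coin_reflection_def)

lemma coin_reflection_nth:
  "coin_reflection p x $ 1 = (2 * cnj (p $ 1) * p $ 1 - 1) * x $ 1 + 2 * p $ 1 * cnj (p $ 2) * x $ 2"
  "coin_reflection p x $ 2 = 2 * cnj (p $ 1) * p $ 2 * x $ 1 + (2 * cnj (p $ 2) * p $ 2 - 1) * x $ 2"
  by (simp_all add: coin_reflection_def cinner_vec2 scaleC_complex_def algebra_simps)

lemma coin_reflection_involution:
  assumes "norm p = 1"
  shows "coin_reflection p (coin_reflection p x) = x"
proof -
  have "cinner p p = 1"
    by (simp add: cinner_self assms)
  then show ?thesis
    by (simp add: coin_reflection_def cinner_diff_right cinner_scaleC_right
        complex_vector.scale_left_diff_distrib [symmetric] flip: diff_diff_eq2)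
qed

lemma cinner_coin_reflection:
  assumes "norm p = 1"
  shows "cinner (coin_reflection p x) (coin_reflection p y) = cinner x y"
proof -
  have "cinner p p = 1"
    by (simp add: cinner_self assms)
  then show ?thesis
    by (simp add: coin_reflection_def cinner_diff_right cinner_diff_left cinner_scaleC_right
        cinner_scaleC_left algebra_simps flip: cinner_commute [of x p])
qed

text \<open>The right side lists the Hermitian unitary matrices of determinant -1, with rows (k, w)
  and (cnj w, -k). This trades the unit vector \<open>p\<close>, in which a reflection is quadratic,
  for parameters \<open>k\<close> and \<open>w\<close> in which the entries are linear. Forwards, k
  = 2 |p1|^2 - 1 and w = 2 p1 cnj p2; backwards, these equations are solved for
  \<open>p\<close>.\<close>

lemma coin_reflection_form:
  fixes f :: "complex ^ 2 \<Rightarrow> complex ^ 2"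
  shows "(\<exists>p. norm p = 1 \<and> coin_reflection p = f) \<longleftrightarrow>
   (\<exists>k w. k\<^sup>2 + (cmod w)\<^sup>2 = 1 \<and>
      f = (\<lambda>x. vector [of_real k * x $ 1 + w * x $ 2, cnj w * x $ 1 - of_real k * x $ 2]))"
proof safe
  fix p :: "complex ^ 2"
  assume p: "norm p = 1"
  define u v where "u = (cmod (p $ 1))\<^sup>2" and "v = (cmod (p $ 2))\<^sup>2"
  have uv: "v = 1 - u"
    using norm_vec2 [of p] p by (simp add: u_def v_def)
  have c: "cnj (p $ 1) * p $ 1 = of_real u" "cnj (p $ 2) * p $ 2 = of_real v"
    unfolding u_def v_def by (simp_all add: complex_norm_square mult.commute del: of_real_power)
  have "(2 * u - 1)\<^sup>2 + (cmod (2 * p $ 1 * cnj (p $ 2)))\<^sup>2 = (2 * u - 1)\<^sup>2 + 4 * u * v"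
    by (simp add: norm_mult power_mult_distrib u_def v_def)
  also have "\<dots> = 1"
    by (simp add: uv power2_eq_square algebra_simps)
  finally have 1: "(2 * u - 1)\<^sup>2 + (cmod (2 * p $ 1 * cnj (p $ 2)))\<^sup>2 = 1" .
  have "coin_reflection p = (\<lambda>x. vector [of_real (2 * u - 1) * x $ 1 + (2 * p $ 1 * cnj (p $ 2)) * x $ 2,
      cnj (2 * p $ 1 * cnj (p $ 2)) * x $ 1 - of_real (2 * u - 1) * x $ 2])"
    by (simp add: fun_eq_iff vec_eq_iff forall_2 coin_reflection_nth c mult.assoc)
      (simp add: uv algebra_simps)
  with 1 show "\<exists>k w. k\<^sup>2 + (cmod w)\<^sup>2 = 1 \<and> coin_reflection p =
      (\<lambda>x. vector [of_real k * x $ 1 + w * x $ 2, cnj w * x $ 1 - of_real k * x $ 2])"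
    by blast
next
  fix k :: real and w :: complex
  assume kw: "k\<^sup>2 + (cmod w)\<^sup>2 = 1"
  show "\<exists>p. norm p = 1 \<and> coin_reflection p =
      (\<lambda>x. vector [of_real k * x $ 1 + w * x $ 2, cnj w * x $ 1 - of_real k * x $ 2])"
  \<comment> \<open>Solving for \<open>p\<close> divides by its first component, which is zero
    exactly when \<open>k = -1\<close>; there the reflection is diagonal and \<open>p\<close> is the
    second basis vector.\<close>
  proof (cases "k = -1")
    case True
    with kw have "w = 0"
      by simp
    with True show ?thesis
      by (intro exI [of _ "vector [0, 1]"])
        (simp add: norm_vec_def L2_set_def sum_2 fun_eq_iff vec_eq_iff forall_2 coin_reflection_nth)
  next
    case False
    have "k\<^sup>2 \<le> 1"
      using kw zero_le_power2 [of "cmod w"] by linarith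
    then have "k > -1"
      using False by (simp add: abs_square_le_1)
    \<comment> \<open>Multiplying \<open>p\<close> by a phase does not change the reflection, so its
      first component may be taken positive; k = 2 q^2 - 1 then determines \<open>q\<close>, and w =
      2 q cnj p2 determines the second component.\<close>
    define q where "q = sqrt ((1 + k) / 2)"
    have q: "q > 0" "q\<^sup>2 = (1 + k) / 2"
      using \<open>k > -1\<close> by (auto simp: q_def)
    have w: "(cmod w)\<^sup>2 = 4 * q\<^sup>2 * (1 - q\<^sup>2)"
      using kw unfolding q(2) by (simp add: power2_eq_square field_simps)
    have cw: "w * cnj w = 4 * (of_real q)\<^sup>2 * (1 - (of_real q)\<^sup>2)"
      using arg_cong [OF w, of complex_of_real] by (simp add: complex_norm_square del: of_real_power flip: of_real_power)
    let ?p = "vector [of_real q, cnj w / (2 * of_real q)] :: complex ^ 2"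
    have "(norm ?p)\<^sup>2 = 1"
      using q(1) by (simp add: norm_vec2 norm_divide norm_mult power_divide power_mult_distrib w)
    then have "norm ?p = 1"
      by (simp add: abs_square_eq_1)
    have k: "of_real k = 2 * (complex_of_real q)\<^sup>2 - 1"
      using arg_cong [OF q(2), of complex_of_real] by (simp add: field_simps)
    have "2 * cnj (?p $ 1) * ?p $ 1 - 1 = of_real k" "2 * cnj (?p $ 2) * ?p $ 2 - 1 = - of_real k"
      using q(1) cw by (simp_all add: k power2_eq_square field_simps)
    moreover have "2 * ?p $ 1 * cnj (?p $ 2) = w" "2 * cnj (?p $ 1) * ?p $ 2 = cnj w"
      using q(1) by simp_all
    ultimately have "coin_reflection ?p =
      (\<lambda>x. vector [of_real k * x $ 1 + w * x $ 2, cnj w * x $ 1 - of_real k * x $ 2])"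
      by (simp only: fun_eq_iff vec_eq_iff forall_2 coin_reflection_nth vector_2) simp
    with \<open>norm ?p = 1\<close> show ?thesis
      by blast
  qed
qed

section \<open>Reduction of the Szegedy property to the individual coins\<close>

context coined_shift
begin

text \<open>The self-adjoint factor \<open>S\<close> is eliminated in favour of edge phases
  \<theta>. Once \<open>lam\<close> and \<theta> are fixed, the right side is a separate condition
  on each coin.\<close>

lemma szegedy_factorization_iff:
  "(\<exists>S lam \<phi>. unitary_on (\<lambda>_. UNIV) S \<and> selfadjoint_on (\<lambda>_. UNIV) S \<and>
      (\<forall>v. norm (\<phi> v :: complex ^ 2) = 1) \<and>
      (\<forall>\<psi>\<in>hilbert_sum (\<lambda>_. UNIV). cis lam *\<^sub>C S (U \<psi>) = (\<lambda>v. coin_reflection (\<phi> v) (\<psi> v)))) \<longleftrightarrow>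
   (\<exists>lam \<theta>. \<forall>n. \<exists>p. norm p = 1 \<and> (\<forall>x. cis lam *\<^sub>C (W n *v x) =
      vector [cis (- \<theta> (n - 1)) * coin_reflection p x $ 2, cis (\<theta> n) * coin_reflection p x $ 1]))"
  (is "?L \<longleftrightarrow> ?R")
proof
  assume ?R
  then obtain lam \<theta> \<phi> where \<phi>: "\<And>n. norm (\<phi> n) = 1"
    and W: "\<And>n x. cis lam *\<^sub>C (W n *v x) =
      vector [cis (- \<theta> (n - 1)) * coin_reflection (\<phi> n) x $ 2, cis (\<theta> n) * coin_reflection (\<phi> n) x $ 1]"
    by metis
  have W1: "cis lam * (W n *v x) $ 1 = cis (- \<theta> (n - 1)) * coin_reflection (\<phi> n) x $ 2"
    and W2: "cis lam * (W n *v x) $ 2 = cis (\<theta> n) * coin_reflection (\<phi> n) x $ 1" for n x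
    using W [of n x] by (auto simp: vec_eq_iff forall_2 scaleC_complex_def)
  \<comment> \<open>The witness for \<open>S\<close> is \<open>flip_flop \<theta>\<close>: it brings
    both components of the coin image back to the site they left and swaps them, which undoes the
    antidiagonal factor in \<open>W n\<close>.\<close>
  have "cis lam *\<^sub>C flip_flop \<theta> (U \<psi>) = (\<lambda>v. coin_reflection (\<phi> v) (\<psi> v))"
    if "\<psi> \<in> hilbert_sum (\<lambda>_. UNIV)" for \<psi>
    by (simp add: fun_eq_iff vec_eq_iff forall_2 scaleC_fun_def scaleC_complex_def flip_flop_def
      U_apply [OF that] mult.left_commute [of "cis lam"] W1 W2)
      (simp add: cis_mult flip: mult.assoc)
  then show ?L
    using unitary_on_flip_flop selfadjoint_on_flip_flop \<phi> by blast
next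
  assume ?L
  then obtain S lam \<phi> where S: "selfadjoint_on (\<lambda>_. UNIV) S" and \<phi>: "\<And>v. norm (\<phi> v :: complex ^ 2) = 1"
    and SU: "\<And>\<psi>. \<psi> \<in> hilbert_sum (\<lambda>_. UNIV) \<Longrightarrow>
      cis lam *\<^sub>C S (U \<psi>) = (\<lambda>v. coin_reflection (\<phi> v) (\<psi> v))"
    by blast
  define D :: "int \<Rightarrow> complex ^ 2 \<Rightarrow> int \<Rightarrow> complex ^ 2" where "D n x = proj_at n (\<lambda>_. x)" for n x
  have D: "D n x \<in> hilbert_sum (\<lambda>_. UNIV)" for n x
    by (simp add: D_def)
  define R where "R n = coin_reflection (\<phi> n)" for n
  have RR: "R n (R n x) = x" for n x
    by (simp add: R_def coin_reflection_involution \<phi>)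
  \<comment> \<open>The reflections act site by site, so \<open>S\<close> returns
    \<open>U (D n x)\<close> to site \<open>n\<close> entirely.\<close>
  have SUD: "S (U (D n x)) = proj_at n (\<lambda>_. cis (- lam) *\<^sub>C R n x)" for n x
  proof -
    have "S (U (D n x)) = cis (- lam) *\<^sub>C cis lam *\<^sub>C S (U (D n x))"
      by (simp add: scaleC_scaleC scaleC_one cis_mult)
    also have "\<dots> = proj_at n (\<lambda>_. cis (- lam) *\<^sub>C R n x)"
      unfolding SU [OF D] by (auto simp: fun_eq_iff scaleC_fun_def D_def proj_at_nth R_def)
    finally show ?thesis .
  qed
  \<comment> \<open>Self-adjointness of \<open>S\<close> is tested on the images of vectors at the
    neighbouring sites \<open>n\<close> and \<open>n + 1\<close>. Inserting \<open>R n\<close> and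
    \<open>R (n + 1)\<close> beforehand makes \<open>S\<close> return \<open>x\<close> and
    \<open>y\<close> up to the phase, as reflections are involutions; each pairing then meets only
    one component of the other image.\<close>
  have key: "cis lam * (cnj (x $ 1) * (W (n + 1) *v R (n + 1) y) $ 1) =
      cis (- lam) * (cnj ((W n *v R n x) $ 2) * y $ 2)" for n x y
  proof -
    have "sum_inner (S (U (D n (R n x)))) (U (D (n + 1) (R (n + 1) y))) =
        sum_inner (U (D n (R n x))) (S (U (D (n + 1) (R (n + 1) y))))"
      using S D U_in_hilbert_sum [OF D] unfolding selfadjoint_on_def by blast
    then show ?thesis
      by (simp add: D_def U_proj_at_const SUD [unfolded D_def] sum_inner_proj_at_left sum_inner_proj_at_right RR cinner_vec2
          scaleC_complex_def cis_cnj mult_ac)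
  qed
  \<comment> \<open>In \<open>key\<close> the variables are separated: the left side depends on
    \<open>x\<close> only through \<open>cnj (x $ 1)\<close>, the right side on \<open>y\<close>
    only through \<open>y $ 2\<close>. Hence both sides are governed by one number per edge, found
    by inserting a basis vector: the first for \<open>x\<close> gives \<open>A1\<close>, the second
    for \<open>y\<close> gives \<open>A2\<close>.\<close>
  define \<eta> where "\<eta> n = cis lam * (W n *v R n (vector [1, 0])) $ 2" for n
  have A1: "cis lam * (W n *v R n y) $ 1 = cnj (\<eta> (n - 1)) * y $ 2" for n y
    using key [of "vector [1, 0]" "n - 1" y] by (simp add: \<eta>_def cis_cnj)
  have A2: "cis lam * (W n *v R n x) $ 2 = \<eta> n * x $ 1" for n x
  proof -
    have "cis lam * (cnj (x $ 1) * (W (n + 1) *v R (n + 1) (vector [0, 1])) $ 1) =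
      cnj (x $ 1) * cnj (\<eta> n)"
      using A1 [of "n + 1" "vector [0, 1]"] by (simp add: mult.left_commute)
    then have "cnj (x $ 1) * cnj (\<eta> n) = cis (- lam) * (cnj ((W n *v R n x) $ 2))"
      using key [of x n "vector [0, 1]"] by simp
    then show ?thesis
      by (metis complex_cnj_cnj complex_cnj_mult cis_cnj mult.commute)
  qed
  \<comment> \<open>The image of the first basis vector under the isometry \<open>W n\<close> after
    \<open>R n\<close> has first component 0 by \<open>A1\<close>, so its second component carries
    the whole norm.\<close>
  have \<eta>: "cmod (\<eta> n) = 1" for n
  proof -
    let ?z = "W n *v R n (vector [1, 0])"
    have "cinner ?z ?z = 1"
      by (simp add: cinner_coin R_def cinner_coin_reflection \<phi>) (simp add: cinner_vec2)
    then have "(cmod (?z $ 1))\<^sup>2 + (cmod (?z $ 2))\<^sup>2 = 1"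
      by (simp add: cinner_self norm_vec2 flip: of_real_add of_real_power)
    moreover have "?z $ 1 = 0"
      using A1 [of n "vector [1, 0]"] by simp
    ultimately show ?thesis
      by (simp add: \<eta>_def norm_mult abs_square_eq_1)
  qed
  define \<theta> where "\<theta> n = Arg (\<eta> n)" for n
  have cis_\<theta>: "cis (\<theta> n) = \<eta> n" for n
    using \<eta> [of n] cis_Arg [of "\<eta> n"] by (cases "\<eta> n = 0") (auto simp: \<theta>_def sgn_eq)
  \<comment> \<open>Evaluating \<open>A1\<close> and \<open>A2\<close> at \<open>R n x\<close>
    cancels the reflection on the left and leaves it on the right.\<close>
  have "cis lam *\<^sub>C (W n *v x) =
      vector [cis (- \<theta> (n - 1)) * R n x $ 2, cis (\<theta> n) * R n x $ 1]" for n x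
    using A1 [of n "R n x"] A2 [of n "R n x"]
    by (simp add: vec_eq_iff forall_2 scaleC_complex_def RR cis_\<theta> flip: cis_cnj)
  then show ?R
    using \<phi> unfolding R_def by blast
qed

end

section \<open>Phase conditions on a single coin\<close>

text \<open>Here \<open>\<theta>'\<close> stands for the phase on the preceding edge. By unitarity
  the top row of the coin is determined by the bottom row and the determinant. Matching the bottom
  row forces \<open>w\<close> and \<open>k\<close>, and the only obstruction is that
  \<open>k\<close> be real, which gives the condition modulo pi since its sign is free. The
  determinant condition then makes the top row match.\<close>

lemma coin_factorization_iff:
  fixes a b c d :: complex
  assumes iso: "\<And>x y. cinner ((vector [vector [a, b], vector [c, d]] :: complex ^ 2 ^ 2) *v x)
      ((vector [vector [a, b], vector [c, d]] :: complex ^ 2 ^ 2) *v y) = cinner x y"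
    and det: "a * d - b * c = cis \<delta>"
    and c: "c = cis \<mu> * of_real r"
  shows "(\<exists>p. norm p = 1 \<and> (\<forall>x. cis lam *\<^sub>C ((vector [vector [a, b], vector [c, d]] :: complex ^ 2 ^ 2) *v x) =
      vector [cis (- \<theta>') * coin_reflection p x $ 2, cis \<theta> * coin_reflection p x $ 1])) \<longleftrightarrow>
    [\<theta> - \<theta>' - 2 * lam = \<delta>] (rmod (2 * pi)) \<and> (r \<noteq> 0 \<longrightarrow> [\<theta> - lam = \<mu>] (rmod pi))"
  (is "?L \<longleftrightarrow> ?R")
proof -
  let ?W = "vector [vector [a, b], vector [c, d]] :: complex ^ 2 ^ 2"
  have mv: "?W *v x = vector [a * x $ 1 + b * x $ 2, c * x $ 1 + d * x $ 2]" for x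
    by (simp add: vec_eq_iff forall_2 matrix_vector_mult_def sum_2)
  have cols: "cnj a * a + cnj c * c = 1" "cnj b * b + cnj d * d = 1" "cnj a * b + cnj c * d = 0"
    using iso [of "vector [1, 0]" "vector [1, 0]"] iso [of "vector [0, 1]" "vector [0, 1]"]
      iso [of "vector [1, 0]" "vector [0, 1]"] by (simp_all add: mv cinner_vec2)
  have cols': "cnj b * a + cnj d * c = 0"
    using arg_cong [OF cols(3), of cnj] by (simp add: mult.commute)
  \<comment> \<open>The inverse of the coin is both its adjoint and its adjugate divided by the
    determinant; comparing entries gives \<open>a\<close> and \<open>b\<close>.\<close>
  have a: "a = cis \<delta> * cnj d"
    using cols cols' unfolding det [symmetric] by algebra
  have b: "b = - cis \<delta> * cnj c"
    using cols cols' unfolding det [symmetric] by algebra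
  have "cis \<delta> * (d * cnj d + c * cnj c) = cis \<delta> * 1"
    using det by (simp add: a b algebra_simps)
  then have "d * cnj d + c * cnj c = 1"
    by simp
  then have "complex_of_real ((cmod c)\<^sup>2 + (cmod d)\<^sup>2) = of_real 1"
    unfolding of_real_add complex_norm_square by (simp add: add.commute)
  then have row2: "(cmod c)\<^sup>2 + (cmod d)\<^sup>2 = 1"
    by (simp only: of_real_eq_iff)
  \<comment> \<open>Naming the reflection \<open>f\<close> isolates the existential that
    \<open>coin_reflection_form\<close> rewrites.\<close>
  have "?L \<longleftrightarrow> (\<exists>f. (\<exists>p. norm p = 1 \<and> coin_reflection p = f) \<and> (\<forall>x. cis lam *\<^sub>C (?W *v x) =
      vector [cis (- \<theta>') * f x $ 2, cis \<theta> * f x $ 1]))"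
    by (safe; blast)
  also have "\<dots> \<longleftrightarrow> (\<exists>k w. k\<^sup>2 + (cmod w)\<^sup>2 = 1 \<and> (\<forall>x. cis lam *\<^sub>C (?W *v x) =
      vector [cis (- \<theta>') * (cnj w * x $ 1 - of_real k * x $ 2),
        cis \<theta> * (of_real k * x $ 1 + w * x $ 2)]))"
    unfolding coin_reflection_form by fastforce
  also have "\<dots> \<longleftrightarrow> (\<exists>k w. k\<^sup>2 + (cmod w)\<^sup>2 = 1 \<and>
      cis lam * a = cis (- \<theta>') * cnj w \<and> cis lam * b = - cis (- \<theta>') * of_real k \<and>
      cis lam * c = cis \<theta> * of_real k \<and> cis lam * d = cis \<theta> * w)" (is "(\<exists>k w. _ \<and> ?P k w) \<longleftrightarrow> (\<exists>k w. _ \<and> ?Q k w)")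
  proof -
    have "?P k w \<longleftrightarrow> ?Q k w" for k w
    proof
      assume P: "?P k w"
      show "?Q k w"
        using P [rule_format, of "vector [1, 0]"] P [rule_format, of "vector [0, 1]"]
        by (simp add: mv vec_eq_iff forall_2 scaleC_complex_def)
    next
      assume "?Q k w"
      then show "?P k w"
        by (simp add: mv vec_eq_iff forall_2 scaleC_complex_def distrib_left right_diff_distrib
            flip: mult.assoc)
    qed
    then show ?thesis
      by simp
  qed
  also have "\<dots> \<longleftrightarrow> ?R"
    (is "?M \<longleftrightarrow> _")
  proof
    assume ?M
    then obtain k w where kw: "k\<^sup>2 + (cmod w)\<^sup>2 = 1" and Q: "?Q k w"
      by blast
    \<comment> \<open>Both sides of the matrix identity have equal determinants; that of the right
      side is the product of the edge phases times
      \<open>k\<^sup>2 + (cmod w)\<^sup>2 = 1\<close>.\<close>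
    have "cis (2 * lam + \<delta>) = cis lam * cis lam * (a * d - b * c)"
      by (simp add: det cis_mult add.assoc)
    also have "\<dots> = (cis lam * a) * (cis lam * d) - (cis lam * b) * (cis lam * c)"
      by (simp add: algebra_simps)
    also have "\<dots> = cis (- \<theta>') * cis \<theta> * (cnj w * w + of_real (k\<^sup>2))"
      using Q by (simp add: algebra_simps power2_eq_square)
    also have "cnj w * w + of_real (k\<^sup>2) = 1"
      using arg_cong [OF kw, of complex_of_real]
      unfolding of_real_add complex_norm_square by (simp add: mult.commute add.commute)
    finally have "cis (2 * lam + \<delta>) = cis (\<theta> - \<theta>')"
      by (simp add: cis_mult)
    then have "[(\<theta> - \<theta>' - 2 * lam) + 2 * lam = \<delta> + 2 * lam] (rmod (2 * pi))"
      by (simp add: cis_eq_iff rcong_sym_iff add.commute)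
    then have "[\<theta> - \<theta>' - 2 * lam = \<delta>] (rmod (2 * pi))"
      by (simp only: rcong_add_right_cancel)
    moreover have "[\<theta> - lam = \<mu>] (rmod pi)" if "r \<noteq> 0"
    proof -
      have "cis (- \<theta>) * (cis lam * c) = of_real k"
        using Q by (simp add: cis_mult flip: mult.assoc)
      \<comment> \<open>Since \<open>k\<close> is real, the imaginary part vanishes; for
        \<open>r \<noteq> 0\<close> this makes the angle a multiple of pi.\<close>
      then have "cis (\<mu> + (lam - \<theta>)) * of_real r = of_real k"
        by (simp add: c cis_mult add.commute add.left_commute flip: mult.assoc)
      then have "sin (\<mu> + (lam - \<theta>)) * r = 0"
        by (auto simp: complex_eq_iff)
      then obtain i where "\<mu> + (lam - \<theta>) = of_int i * pi"
        using \<open>r \<noteq> 0\<close> by (auto simp: sin_zero_iff_int2)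
      then show ?thesis
        by (auto simp: rcong_altdef algebra_simps intro!: exI [of _ i])
    qed
    ultimately show ?R
      by simp
  next
    assume R: ?R
    have "cis (\<theta> - \<theta>' - 2 * lam) = cis \<delta>"
      using R by (simp add: cis_eq_iff)
    then have "cis lam * cis \<delta> = cis (lam + (\<theta> - \<theta>' - 2 * lam))"
      by (simp only: cis_mult flip: \<open>cis (\<theta> - \<theta>' - 2 * lam) = cis \<delta>\<close>)
    also have "lam + (\<theta> - \<theta>' - 2 * lam) = - \<theta>' + (\<theta> - lam)"
      by simp
    finally have phase: "cis lam * cis \<delta> = cis (- \<theta>') * cis (\<theta> - lam)"
      by (simp only: cis_mult)
    \<comment> \<open>The equation for \<open>c\<close> leaves this as the only candidate for
      \<open>k\<close>. It is 0 when \<open>r = 0\<close>; otherwise its angle is a multiple of pi,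
      so it is real.\<close>
    have "\<exists>k. of_real k = cis (lam - \<theta>) * c"
    proof (cases "r = 0")
      case False
      then obtain i where "\<mu> = \<theta> - lam + of_int i * pi"
        using R by (auto simp: rcong_altdef)
      then have "cis (lam - \<theta>) * c = cis (of_int i * pi) * of_real r"
        by (simp add: c cis_mult flip: mult.assoc)
      moreover have "sin (of_int i * pi) = 0"
        by (auto simp: sin_zero_iff_int2)
      ultimately show ?thesis
        by (intro exI [of _ "cos (of_int i * pi) * r"]) (simp add: complex_eq_iff)
    qed (simp add: c)
    then obtain k where k: "of_real k = cis (lam - \<theta>) * c"
      by blast
    define w where "w = cis (lam - \<theta>) * d"
    have "cmod (of_real k) = cmod c" "cmod w = cmod d"
      by (simp_all add: k w_def norm_mult del: norm_of_real)
    then have "k\<^sup>2 + (cmod w)\<^sup>2 = 1"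
      using row2 by simp (metis power2_abs)
    moreover have "cis lam * a = cis (- \<theta>') * cnj w"
    proof -
      have "cis lam * a = (cis lam * cis \<delta>) * cnj d"
        by (simp only: a mult.assoc)
      then show ?thesis
        by (simp add: phase w_def cis_cnj mult.assoc)
    qed
    moreover have "cis lam * b = - cis (- \<theta>') * of_real k"
    proof -
      have "cis lam * b = - (cis lam * cis \<delta>) * cnj c"
        by (simp only: b mult.assoc mult_minus_left mult_minus_right)
      \<comment> \<open>As \<open>k\<close> is real, it equals its own conjugate, which introduces
        the \<open>cnj c\<close> that occurs in \<open>b\<close>.\<close>
      moreover have "of_real k = cis (\<theta> - lam) * cnj c"
        using arg_cong [OF k, of cnj] by (simp add: cis_cnj)
      ultimately show ?thesis
        by (simp only: phase mult.assoc mult_minus_left)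
    qed
    moreover have "cis lam * c = cis \<theta> * of_real k" "cis lam * d = cis \<theta> * w"
      by (simp_all add: k w_def cis_mult flip: mult.assoc)
    ultimately show ?M
      by auto
  qed
  finally show ?thesis .
qed

section \<open>The graph of a one-dimensional walk\<close>

lemma one_dimensional_walk_card:
  assumes "one_dimensional_walk U H"
  shows "walk_card U H m n = (if \<bar>m - n\<bar> = 1 then 1 else 0)"
proof (cases "\<bar>m - n\<bar> = 1")
  case False
  then have "\<forall>\<psi>\<in>hilbert_sum H. walk_block U m n \<psi> = 0"
    using assms unfolding one_dimensional_walk_def by blast
  then have sub: "walk_block U m n ` hilbert_sum H \<subseteq> {0}"
    by blast
  have "cdim (walk_block U m n ` hilbert_sum H) = 0"
    using sub by (intro complex_vector.dim_unique [of "{}"]) (simp_all add: complex_vector.span_empty complex_vector.independent_empty)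
  \<comment> \<open>Without a finite spanning set \<open>cdimension\<close> would take the value
    \<infinity>, so \<open>cdim\<close> being 0 does not settle the claim.\<close>
  moreover have "\<exists>B. finite B \<and> walk_block U m n ` hilbert_sum H \<subseteq> cspan B"
    using sub by (intro exI [of _ "{}"]) auto
  ultimately show ?thesis
    using False by (simp add: walk_card_def cdimension_def zero_enat_def)
next
  case True
  then have "walk_card U H m n = 1"
    using assms unfolding one_dimensional_walk_def by blast
  with True show ?thesis
    by simp
qed

text \<open>Each site has exactly one edge to either neighbour, and these two outgoing edges match
  the dimension 2. In the theorem this reduces the Szegedy property to the existence of
  \<open>S\<close>, \<open>lam\<close> and the unit vectors.\<close>

lemma standard_walk_one_dimensional:
  assumes "one_dimensional_walk U H"
  shows "standard_walk U H"
proof -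
  have neighbour: "\<bar>u - v\<bar> = 1 \<longleftrightarrow> u = v + 1 \<or> u = v - 1" for u v :: int
    by linarith
  have "enat k < (if P then 1 else 0) \<longleftrightarrow> P \<and> k = 0" for k P
    by (simp add: one_enat_def zero_enat_def)
  then have edges: "walk_edges U H = {(v, u, k). (u = v + 1 \<or> u = v - 1) \<and> k = 0}"
    by (simp only: walk_edges_def one_dimensional_walk_card [OF assms] neighbour)
  have "finite {(v, u, k). (v, u, k) \<in> walk_edges U H \<and> (v = x \<or> u = x)}" for x
    by (rule finite_subset [of _ "{(x, x + 1, 0), (x, x - 1, 0), (x + 1, x, 0), (x - 1, x, 0)}"])
      (auto simp: edges)
  moreover have "{(v, u, k). (v, u, k) \<in> walk_edges U H \<and> v = x} = {(x, x + 1, 0), (x, x - 1, 0)}" for x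
    by (auto simp: edges)
  then have "card {(v, u, k). (v, u, k) \<in> walk_edges U H \<and> v = x} = 2" for x
    by simp
  moreover have "walk_card U H u v = walk_card U H v u" for u v
    by (simp only: one_dimensional_walk_card [OF assms] abs_minus_commute [of u v])
  moreover have "cdimension (H x) = enat 2" for x
    using assms by (simp only: one_dimensional_walk_def numeral_eq_enat)
  ultimately show ?thesis
    using assms by (simp only: standard_walk_def one_dimensional_walk_def simp_thms)
qed

section \<open>Assembly of the coin conditions over all sites\<close>

theorem theorem6p1:
  fixes U :: "(int \<Rightarrow> complex ^ 2) \<Rightarrow> (int \<Rightarrow> complex ^ 2)"
    and r s \<mu> \<nu> \<sigma> \<tau> \<delta> :: "int \<Rightarrow> real"
  assumes "one_dimensional_walk U (\<lambda>_. UNIV)"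
    and "\<And>n. r n \<ge> 0" and "\<And>n. s n \<ge> 0"
    and "\<And>n \<psi>. \<psi> \<in> hilbert_sum (\<lambda>_. UNIV) \<Longrightarrow>
      walk_block U (n - 1) n \<psi> =
        ket_bra (n - 1) n
          (vector [vector [cis (\<sigma> n) * of_real (s n), cis (\<nu> n) * of_real (r n)],
                   vector [0, 0]]) \<psi>"
    and "\<And>n \<psi>. \<psi> \<in> hilbert_sum (\<lambda>_. UNIV) \<Longrightarrow>
      walk_block U (n + 1) n \<psi> =
        ket_bra (n + 1) n
          (vector [vector [0, 0],
                   vector [cis (\<mu> n) * of_real (r n), cis (\<tau> n) * of_real (s n)]]) \<psi>"
    and "\<And>n. cis (\<delta> n) =
      det (vector [vector [cis (\<sigma> n) * of_real (s n), cis (\<nu> n) * of_real (r n)],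
                   vector [cis (\<mu> n) * of_real (r n), cis (\<tau> n) * of_real (s n)]]
             :: complex ^ 2 ^ 2)"
  shows "szegedy_walk U (\<lambda>_. UNIV) \<longleftrightarrow>
    (\<exists>(lam :: real) (\<theta> :: int \<Rightarrow> real).
      (\<forall>n. [\<theta> n - \<theta> (n - 1) - 2 * lam = \<delta> n] (rmod (2 * pi))) \<and>
      (\<forall>n. r n \<noteq> 0 \<longrightarrow> [\<theta> n - lam = \<mu> n] (rmod pi)))"
proof -
  define W :: "int \<Rightarrow> complex ^ 2 ^ 2" where
    "W n = vector [vector [cis (\<sigma> n) * of_real (s n), cis (\<nu> n) * of_real (r n)],
      vector [cis (\<mu> n) * of_real (r n), cis (\<tau> n) * of_real (s n)]]" for n
  interpret coined_shift U W
  proof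
    show "unitary_on (\<lambda>_. UNIV) U"
      using assms(1) by (simp add: one_dimensional_walk_def quantum_walk_def)
    fix \<psi> :: "int \<Rightarrow> complex ^ 2" and n m
    assume \<psi>: "\<psi> \<in> hilbert_sum (\<lambda>_. UNIV)"
    have block: "U (proj_at n \<psi>) m = walk_block U m n \<psi> m"
      by (simp add: walk_block_def proj_at_nth)
    consider "m = n - 1" | "m = n + 1" | "\<bar>m - n\<bar> \<noteq> 1"
      by linarith
    then show "U (proj_at n \<psi>) m = (if m = n - 1 then vector [(W n *v \<psi> n) $ 1, 0]
       else if m = n + 1 then vector [0, (W n *v \<psi> n) $ 2] else 0)"
    proof cases
      case 1
      then show ?thesis
        unfolding block using assms(4) [OF \<psi>, of n]
        by (simp add: ket_bra_def W_def vec_eq_iff forall_2 matrix_vector_mult_def sum_2)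
    next
      case 2
      then show ?thesis
        unfolding block using assms(5) [OF \<psi>, of n]
        by (simp add: ket_bra_def W_def vec_eq_iff forall_2 matrix_vector_mult_def sum_2)
    next
      case 3
      then show ?thesis
        using assms(1) \<psi> by (auto simp: block one_dimensional_walk_def)
    qed
  qed
  \<comment> \<open>The hypotheses of \<open>coin_factorization_iff\<close> are met because
    \<open>cinner_coin\<close> makes the coin isometric and \<open>\<delta> n\<close> is the angle
    of its determinant; \<open>\<theta>'\<close> is taken to be
    \<open>\<theta> (n - 1)\<close>.\<close>
  have coin: "(\<exists>p. norm p = 1 \<and> (\<forall>x. cis lam *\<^sub>C (W n *v x) =
      vector [cis (- \<theta> (n - 1)) * coin_reflection p x $ 2, cis (\<theta> n) * coin_reflection p x $ 1])) \<longleftrightarrow>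
    [\<theta> n - \<theta> (n - 1) - 2 * lam = \<delta> n] (rmod (2 * pi)) \<and> (r n \<noteq> 0 \<longrightarrow> [\<theta> n - lam = \<mu> n] (rmod pi))"
    for lam \<theta> n
    unfolding W_def
    by (rule coin_factorization_iff) (use cinner_coin [of n] assms(6) [of n] in \<open>simp_all add: W_def det_2\<close>)
  have "szegedy_walk U (\<lambda>_. UNIV) \<longleftrightarrow>
    (\<exists>S lam \<phi>. unitary_on (\<lambda>_. UNIV) S \<and> selfadjoint_on (\<lambda>_. UNIV) S \<and>
      (\<forall>v. norm (\<phi> v :: complex ^ 2) = 1) \<and>
      (\<forall>\<psi>\<in>hilbert_sum (\<lambda>_. UNIV). cis lam *\<^sub>C S (U \<psi>) = (\<lambda>v. coin_reflection (\<phi> v) (\<psi> v))))"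
    using standard_walk_one_dimensional [OF assms(1)]
    by (simp add: szegedy_walk_def coin_reflection_def)
  then show ?thesis
    unfolding szegedy_factorization_iff coin by (simp add: all_conj_distrib)
qed

end
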